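(* Within the set of two-person symmetric games, the set of games with a unique symmetric Nash equilibrium is not open: there exists an integer $m$ such that, within the space of two-person symmetric games of size $m\times m$, the set of games having a unique symmetric Nash equilibrium is not open.
   Context: A two-person game of size $m\times m$ has strategy sets $S^1,S^2$ of cardinality $m$ and utility functions $U^1,U^2:S^1\times S^2\to\mathbb{R}$. It is symmetric if $S^1=S^2$ (after identification) and $U^2(s,t)=U^1(t,s)$ for all $s,t$. The space of symmetric $m\times m$ games carries the topology induced from the payoff space (equivalently, it is identified with the space of $m\times m$ real matrices, the payoff matrix of player 1). A symmetric Nash equilibrium is a Nash equilibrium in mixed strategies $(\sigma^1,\sigma^2)$ with $\sigma^1=\sigma^2$. *)

theory Defs
  imports "HOL-Analysis.Analysis"
begin

text \<open>A two-person game with finite strategy sets \<open>S1\<close> and \<open>S2\<close> is the pair of its utility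
  functions, taken to be extensional on \<open>S1 \<times> S2\<close> so that a game is determined by its payoffs.\<close>

type_synonym ('a, 'b) game = "('a \<times> 'b \<Rightarrow> real) \<times> ('a \<times> 'b \<Rightarrow> real)"

definition game_topology :: "'a set \<Rightarrow> 'b set \<Rightarrow> ('a, 'b) game topology" where
  "game_topology S1 S2 = prod_topology (powertop_real (S1 \<times> S2)) (powertop_real (S1 \<times> S2))"

definition games :: "'a set \<Rightarrow> 'b set \<Rightarrow> ('a, 'b) game set" where
  "games S1 S2 = ((S1 \<times> S2) \<rightarrow>\<^sub>E UNIV) \<times> ((S1 \<times> S2) \<rightarrow>\<^sub>E UNIV)"

lemma topspace_game_topology: "topspace (game_topology S1 S2) = games S1 S2"
  by (simp add: game_topology_def games_def)

definition symmetric_games :: "'a set \<Rightarrow> ('a, 'a) game set" where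
  "symmetric_games S =
     {(U1, U2). (U1, U2) \<in> games S S \<and> (\<forall>s\<in>S. \<forall>t\<in>S. U2 (s, t) = U1 (t, s))}"

text \<open>Mixed strategies are extensional as well, so that \<open>\<exists>!\<close> counts them correctly.\<close>

definition mixed_strategies :: "'a set \<Rightarrow> ('a \<Rightarrow> real) set" where
  "mixed_strategies S = {\<sigma> \<in> S \<rightarrow>\<^sub>E UNIV. (\<forall>s\<in>S. 0 \<le> \<sigma> s) \<and> (\<Sum>s\<in>S. \<sigma> s) = 1}"

definition expected_utility ::
    "'a set \<Rightarrow> 'b set \<Rightarrow> ('a \<times> 'b \<Rightarrow> real) \<Rightarrow> ('a \<Rightarrow> real) \<Rightarrow> ('b \<Rightarrow> real) \<Rightarrow> real" where
  "expected_utility S1 S2 U \<sigma> \<tau> = (\<Sum>s\<in>S1. \<Sum>t\<in>S2. \<sigma> s * \<tau> t * U (s, t))"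

definition nash_equilibria ::
    "'a set \<Rightarrow> 'b set \<Rightarrow> ('a, 'b) game \<Rightarrow> (('a \<Rightarrow> real) \<times> ('b \<Rightarrow> real)) set" where
  "nash_equilibria S1 S2 G =
     {(\<sigma>1, \<sigma>2). \<sigma>1 \<in> mixed_strategies S1 \<and> \<sigma>2 \<in> mixed_strategies S2 \<and>
        (\<forall>\<tau>\<in>mixed_strategies S1.
           expected_utility S1 S2 (fst G) \<tau> \<sigma>2 \<le> expected_utility S1 S2 (fst G) \<sigma>1 \<sigma>2) \<and>
        (\<forall>\<tau>\<in>mixed_strategies S2.
           expected_utility S1 S2 (snd G) \<sigma>1 \<tau> \<le> expected_utility S1 S2 (snd G) \<sigma>1 \<sigma>2)}"

definition symmetric_nash_equilibria ::
    "'a set \<Rightarrow> ('a, 'a) game \<Rightarrow> (('a \<Rightarrow> real) \<times> ('a \<Rightarrow> real)) set" where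
  "symmetric_nash_equilibria S G = {(\<sigma>1, \<sigma>2). (\<sigma>1, \<sigma>2) \<in> nash_equilibria S S G \<and> \<sigma>1 = \<sigma>2}"

end

theory Submission
  imports Defs
begin

text \<open>Consider the payoff matrix of player 1 with rows \<open>(0, 0, 0)\<close>, \<open>(e, -1, -2)\<close> and
  \<open>(e, -2, -1)\<close>. For \<open>e = 0\<close> every strategy that uses row 1 or 2 earns a negative payoff against
  itself, so the first pure strategy is the only symmetric equilibrium, but it is not quasi-strict.
  For \<open>e > 0\<close> each of the rows 1 and 2 can be mixed with row 0 in the ratio \<open>e : 1\<close>: rows 0 and the
  chosen one then both earn 0 and the remaining one earns less, because the matrix \<open>(1, 2; 2, 1)\<close>
  has positive entries without being a P-matrix.\<close>

lemma expected_utility_transpose: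
  assumes "\<And>s t. s \<in> S \<Longrightarrow> t \<in> S \<Longrightarrow> U2 (s, t) = U1 (t, s)"
  shows "expected_utility S S U2 \<sigma> \<tau> = expected_utility S S U1 \<tau> \<sigma>"
proof -
  have "expected_utility S S U2 \<sigma> \<tau> = (\<Sum>s\<in>S. \<Sum>t\<in>S. \<tau> t * \<sigma> s * U1 (t, s))"
    unfolding expected_utility_def by (intro sum.cong refl) (simp add: assms)
  also have "\<dots> = expected_utility S S U1 \<tau> \<sigma>"
    unfolding expected_utility_def by (rule sum.swap)
  finally show ?thesis .
qed

text \<open>By transposition, player 2's best-reply condition at a profile
  \<open>(\<sigma>, \<sigma>)\<close> is the same as player 1's, so a single condition on
  \<open>U1\<close> remains.\<close>

lemma symmetric_nash_equilibria_iff: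
  assumes "(U1, U2) \<in> symmetric_games S"
  shows "p \<in> symmetric_nash_equilibria S (U1, U2) \<longleftrightarrow>
    (\<exists>\<sigma>\<in>mixed_strategies S. p = (\<sigma>, \<sigma>) \<and>
      (\<forall>\<tau>\<in>mixed_strategies S. expected_utility S S U1 \<tau> \<sigma> \<le> expected_utility S S U1 \<sigma> \<sigma>))"
proof -
  have "expected_utility S S U2 \<sigma> \<tau> = expected_utility S S U1 \<tau> \<sigma>" for \<sigma> \<tau>
    using assms by (intro expected_utility_transpose) (auto simp: symmetric_games_def)
  then show ?thesis
    by (auto simp: symmetric_nash_equilibria_def nash_equilibria_def)
qed

definition pay :: "real \<Rightarrow> nat \<times> nat \<Rightarrow> real" where
  "pay e = (\<lambda>(s, t)\<in>{..<3} \<times> {..<3}.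
     if s = 0 then 0 else if t = 0 then e else if s = t then -1 else -2)"

definition sym_game :: "real \<Rightarrow> (nat, nat) game" where
  "sym_game e = (pay e, (\<lambda>(s, t)\<in>{..<3} \<times> {..<3}. pay e (t, s)))"

definition mix3 :: "real \<Rightarrow> real \<Rightarrow> real \<Rightarrow> nat \<Rightarrow> real" where
  "mix3 a b c = (\<lambda>i\<in>{..<3}. if i = 0 then a else if i = 1 then b else c)"

lemma lessThan_3: "{..<3::nat} = {0, 1, 2}"
  by auto

lemma mixed_strategies_3:
  "\<sigma> \<in> mixed_strategies {..<3::nat} \<longleftrightarrow>
    (\<exists>a b c. 0 \<le> a \<and> 0 \<le> b \<and> 0 \<le> c \<and> a + b + c = 1 \<and> \<sigma> = mix3 a b c)"
proof
  assume \<sigma>: "\<sigma> \<in> mixed_strategies {..<3}"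
  have "\<sigma> = mix3 (\<sigma> 0) (\<sigma> 1) (\<sigma> 2)"
  proof
    fix i :: nat
    \<comment> \<open>For \<open>i \<ge> 3\<close> both sides are \<open>undefined\<close> by
      extensionality.\<close>
    consider "i = 0" | "i = 1" | "i = 2" | "i \<ge> 3" by linarith
    then show "\<sigma> i = mix3 (\<sigma> 0) (\<sigma> 1) (\<sigma> 2) i"
      using \<sigma> by cases (auto simp: mixed_strategies_def mix3_def PiE_def extensional_def)
  qed
  moreover have "0 \<le> \<sigma> 0" "0 \<le> \<sigma> 1" "0 \<le> \<sigma> 2" "\<sigma> 0 + \<sigma> 1 + \<sigma> 2 = 1"
    using \<sigma> by (auto simp: mixed_strategies_def lessThan_3)
  ultimately show "\<exists>a b c. 0 \<le> a \<and> 0 \<le> b \<and> 0 \<le> c \<and> a + b + c = 1 \<and> \<sigma> = mix3 a b c"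
    by blast
next
  assume "\<exists>a b c. 0 \<le> a \<and> 0 \<le> b \<and> 0 \<le> c \<and> a + b + c = 1 \<and> \<sigma> = mix3 a b c"
  then obtain a b c where abc: "0 \<le> a" "0 \<le> b" "0 \<le> c" "a + b + c = 1" "\<sigma> = mix3 a b c"
    by blast
  then have "\<sigma> \<in> {..<3} \<rightarrow>\<^sub>E UNIV" "\<forall>s\<in>{..<3}. 0 \<le> \<sigma> s"
    by (simp_all add: mix3_def)
  moreover have "(\<Sum>s<3. \<sigma> s) = 1"
    using abc(4) by (simp add: abc(5) mix3_def lessThan_3)
  ultimately show "\<sigma> \<in> mixed_strategies {..<3}"
    by (simp only: mixed_strategies_def mem_Collect_eq simp_thms)
qed

text \<open>Row 0 is zero, so \<open>x\<close> contributes nothing; the two brackets are the payoffs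
  of the pure strategies 1 and 2 against \<open>mix3 a b c\<close>.\<close>

lemma expected_utility_pay:
  "expected_utility {..<3} {..<3} (pay e) (mix3 x y z) (mix3 a b c) =
    y * (e * a - b - 2 * c) + z * (e * a - 2 * b - c)"
  by (simp add: expected_utility_def pay_def mix3_def lessThan_3 algebra_simps)

lemma sym_game_symmetric: "sym_game e \<in> symmetric_games {..<3}"
  by (auto simp: sym_game_def pay_def symmetric_games_def games_def)

lemma symmetric_nash_equilibria_sym_game:
  "p \<in> symmetric_nash_equilibria {..<3} (sym_game e) \<longleftrightarrow>
    (\<exists>\<sigma>\<in>mixed_strategies {..<3}. p = (\<sigma>, \<sigma>) \<and>
      (\<forall>\<tau>\<in>mixed_strategies {..<3}. expected_utility {..<3} {..<3} (pay e) \<tau> \<sigma>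
         \<le> expected_utility {..<3} {..<3} (pay e) \<sigma> \<sigma>))"
  using sym_game_symmetric[of e] unfolding sym_game_def by (rule symmetric_nash_equilibria_iff)

text \<open>Since \<open>y\<close> and \<open>z\<close> range over the whole quadrant, the last
  hypothesis amounts to this: rows 1 and 2 earn at most 0 against the mixture, and the mixture earns
  exactly 0, the payoff of row 0. All equilibria exhibited below are of this kind.\<close>

lemma mix3_equilibrium:
  assumes "0 \<le> a" "0 \<le> b" "0 \<le> c" "a + b + c = 1"
    and "\<And>y z. 0 \<le> y \<Longrightarrow> 0 \<le> z \<Longrightarrow>
      y * (e * a - b - 2 * c) + z * (e * a - 2 * b - c)
        \<le> b * (e * a - b - 2 * c) + c * (e * a - 2 * b - c)"
  shows "(mix3 a b c, mix3 a b c) \<in> symmetric_nash_equilibria {..<3} (sym_game e)"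
proof -
  have "expected_utility {..<3} {..<3} (pay e) \<tau> (mix3 a b c)
      \<le> expected_utility {..<3} {..<3} (pay e) (mix3 a b c) (mix3 a b c)"
    if "\<tau> \<in> mixed_strategies {..<3}" for \<tau>
    using that assms(5) unfolding mixed_strategies_3
    by (elim exE conjE) (simp only: expected_utility_pay)
  moreover have "mix3 a b c \<in> mixed_strategies {..<3}"
    using assms(1-4) unfolding mixed_strategies_3 by blast
  ultimately show ?thesis
    unfolding symmetric_nash_equilibria_sym_game by blast
qed

lemma unique_equilibrium_at_0: "\<exists>!p. p \<in> symmetric_nash_equilibria {..<3} (sym_game 0)"
proof
  let ?p = "mix3 1 0 0"
  have mem: "?p \<in> mixed_strategies {..<3}"
    unfolding mixed_strategies_3 by (intro exI[of _ 1] exI[of _ 0]) simp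
  show "(?p, ?p) \<in> symmetric_nash_equilibria {..<3} (sym_game 0)"
    by (intro mix3_equilibrium) simp_all
  fix q assume "q \<in> symmetric_nash_equilibria {..<3} (sym_game 0)"
  then obtain \<sigma> where \<sigma>: "\<sigma> \<in> mixed_strategies {..<3}" "q = (\<sigma>, \<sigma>)"
    and opt: "expected_utility {..<3} {..<3} (pay 0) ?p \<sigma>
      \<le> expected_utility {..<3} {..<3} (pay 0) \<sigma> \<sigma>"
    using mem unfolding symmetric_nash_equilibria_sym_game by blast
  from \<sigma>(1) obtain a b c where abc: "0 \<le> b" "0 \<le> c" "a + b + c = 1" "\<sigma> = mix3 a b c"
    unfolding mixed_strategies_3 by blast
  \<comment> \<open>One deviation is enough: the first pure strategy earns 0, while
    \<open>\<sigma>\<close> earns minus this quadratic form against itself.\<close>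
  have "b * b + c * c + 4 * (b * c) \<le> 0"
    using opt by (simp add: abc(4) expected_utility_pay algebra_simps)
  moreover have "0 \<le> b * b" "0 \<le> c * c" "0 \<le> b * c"
    using abc by auto
  ultimately have "b * b = 0" "c * c = 0"
    by linarith+
  then show "q = (?p, ?p)"
    using \<sigma>(2) abc by simp
qed

lemma two_equilibria_if_pos:
  assumes "e > 0"
  shows "\<not> (\<exists>!p. p \<in> symmetric_nash_equilibria {..<3} (sym_game e))"
proof -
  \<comment> \<open>The weight \<open>e * a\<close> on row 1 makes that row earn
    \<open>e * a - e * a = 0\<close> against \<open>?\<sigma>\<close>, as row 0 does; normalisation
    then fixes \<open>a\<close>. Row 2 earns \<open>e * a - 2 * (e * a) < 0\<close>. Exchanging rows
    1 and 2 gives \<open>?\<tau>\<close>.\<close>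
  define a where "a = 1 / (1 + e)"
  have a: "a > 0" "a + e * a = 1"
    using assms by (auto simp: a_def field_simps)
  let ?\<sigma> = "mix3 a (e * a) 0" and ?\<tau> = "mix3 a 0 (e * a)"
  have "(?\<sigma>, ?\<sigma>) \<in> symmetric_nash_equilibria {..<3} (sym_game e)"
    using a assms by (intro mix3_equilibrium) (simp_all add: mult_nonneg_nonpos)
  moreover have "(?\<tau>, ?\<tau>) \<in> symmetric_nash_equilibria {..<3} (sym_game e)"
    using a assms by (intro mix3_equilibrium) (simp_all add: mult_nonneg_nonpos)
  moreover have "?\<sigma> 1 \<noteq> ?\<tau> 1"
    using a assms by (simp add: mix3_def)
  ultimately show ?thesis
    by (metis fst_conv)
qed

lemma continuous_map_sym_game:
  "continuous_map euclideanreal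
     (subtopology (game_topology {..<3} {..<3}) (symmetric_games {..<3})) sym_game"
proof -
  have cont: "continuous_map euclideanreal euclideanreal (\<lambda>e. pay e k)"
    if "k \<in> {..<3} \<times> {..<3}" for k
    \<comment> \<open>Only column 0 can depend on \<open>e\<close>, and there an entry is 0 or
      \<open>e\<close> itself.\<close>
    using that by (cases k; cases "snd k = 0") (auto simp: pay_def)
  have "continuous_map euclideanreal (powertop_real ({..<3} \<times> {..<3})) pay"
    using cont by (auto simp: continuous_map_componentwise pay_def)
  moreover have "continuous_map euclideanreal (powertop_real ({..<3} \<times> {..<3}))
      (\<lambda>e. \<lambda>(s, t)\<in>{..<3} \<times> {..<3}. pay e (t, s))"
    using cont by (auto simp: continuous_map_componentwise)
  ultimately have "continuous_map euclideanreal (game_topology {..<3} {..<3}) sym_game"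
    unfolding game_topology_def sym_game_def[abs_def] by (intro continuous_map_pairedI)
  then show ?thesis
    using sym_game_symmetric by (auto simp: continuous_map_in_subtopology)
qed

theorem mainTheorem4:
  "\<exists>m::nat. m \<ge> 1 \<and>
     \<not> openin (subtopology (game_topology {..<m} {..<m}) (symmetric_games {..<m}))
         {G \<in> symmetric_games {..<m}. \<exists>!\<sigma>. \<sigma> \<in> symmetric_nash_equilibria {..<m} G}"
proof (intro exI conjI notI)
  define W where
    "W = {G \<in> symmetric_games {..<3::nat}. \<exists>!\<sigma>. \<sigma> \<in> symmetric_nash_equilibria {..<3} G}"
  \<comment> \<open>This instantiates the size left open by \<open>exI\<close> with 3.\<close>
  show "(3::nat) \<ge> 1" by simp
  assume "openin (subtopology (game_topology {..<3::nat} {..<3}) (symmetric_games {..<3}))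
    {G \<in> symmetric_games {..<3}. \<exists>!\<sigma>. \<sigma> \<in> symmetric_nash_equilibria {..<3} G}"
  then have "openin (subtopology (game_topology {..<3} {..<3}) (symmetric_games {..<3})) W"
    unfolding W_def .
  \<comment> \<open>Pulling \<open>W\<close> back along the curve \<open>sym_game\<close> moves the
    question to the real line, where 0 would have to be an interior point.\<close>
  from openin_continuous_map_preimage[OF continuous_map_sym_game this]
  have "open {e. sym_game e \<in> W}"
    by simp
  moreover have "0 \<in> {e. sym_game e \<in> W}"
    using sym_game_symmetric unique_equilibrium_at_0 unfolding W_def by blast
  ultimately obtain d where d: "d > 0" "ball 0 d \<subseteq> {e. sym_game e \<in> W}"
    by (rule openE)
  \<comment> \<open>Any positive point of the ball gives the contradiction, since uniqueness fails
    for every \<open>e > 0\<close>.\<close>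
  have "d / 2 \<in> ball 0 d"
    using d(1) by simp
  then have "sym_game (d / 2) \<in> W"
    using d(2) by blast
  then have "\<exists>!\<sigma>. \<sigma> \<in> symmetric_nash_equilibria {..<3} (sym_game (d / 2))"
    unfolding W_def mem_Collect_eq by (rule conjunct2)
  moreover have "d / 2 > 0"
    using d(1) by simp
  ultimately show False
    using two_equilibria_if_pos by blast
qed

end
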